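(* Let $n\ge 1$ and let $\alpha$ be a composition of $n$. Let $X$ be the set of all tableaux of shape $\alpha$ and content $(1^n)$, and let $Y$ be the set of all pairs $(P,J)$ where $P$ is a standard immaculate tableau of shape $\alpha$ and $J$ is a hook tableau of shape $\alpha$. Then the map $\psi: Y\to X$ (the map defined in the context by successive circular right shifts along the paths encoded by $J$) is a bijection from $Y$ to $X$.
   Context: A composition of a positive integer $n$ is a tuple $\alpha=(\alpha_1,\dots,\alpha_k)$ of positive integers with $\sum_i\alpha_i=n$; its length is $\ell(\alpha)=k$. Its diagram is the left-justified array with $\alpha_i$ cells in row $i$; rows are numbered from top to bottom, columns from left to right, and $(i,j)$ denotes the cell in row $i$ and column $j$. Write $(i,j)\in\alpha$ if $1\le i\le \ell(\alpha)$ and $1\le j\le\alpha_i$. Hooks: for $(i,j)\in\alpha$, the hook is $H_{i,j}=\{(i',j') : i\le i'\le \ell(\alpha),\ 1\le j'\le\alpha_{i'}\}$ if $j=1$, and $H_{i,j}=\{(i,j') : j\le j'\le\alpha_i\}$ if $j>1$. The hook-length is $h_{i,j}=|H_{i,j}|$. Tableaux: a tableau of shape $\alpha$ is a filling $T=(T_{ij})$ of the diagram of $\alpha$ with positive integers, with the convention $T_{ij}=\infty$ if $(i,j)\notin\alpha$. It has content $(1^n)$ if each of $1,\dots,n$ appears exactly once. For $(i,j)\in\alpha$, the entry $T_{ij}$ is stable in $T$ if either $j>1$ and $T_{ij}\le T_{i,j+1}$, or $j=1$ and $T_{ij}<T_{i+1,j}$ and $T_{ij}\le T_{i,j+1}$.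 A standard immaculate tableau of shape $\alpha$ is a tableau of shape $\alpha$ and content $(1^n)$ all of whose entries are stable. A hook tableau of shape $\alpha$ is an array $J=(J_{ij})_{(i,j)\in\alpha}$ with $J_{ij}\in\{1,\dots,h_{i,j}\}$ for every $(i,j)\in\alpha$. Total order on cells: $(i,j)\le(i',j')$ if and only if $j>j'$, or $j=j'$ and $i\ge i'$. Label the cells of $\alpha$ in this order as $c_1<c_2<\cdots<c_n$. Definition of $\psi$: given $(P,J)\in Y$, put $(P_1,J_1)=(P,J)$. Given $(P_k,J_k)$ with $1\le k<n$, let $(i,j)=c_{n+1-k}$. Let $(i',j')$ be the $(J_k)_{ij}$-th cell of $H_{i,j}$, where the cells of $H_{i,j}$ are read row by row, rows from top to bottom and each row from left to right. Define a path $L$ (an ordered list of cells): if $i'=i$, then $L=\{(i,j),(i,j+1),\dots,(i,j')\}$; if $i'\ne i$ (so necessarily $i<i'$ and $j=1$), then $L=\{(i,1),(i+1,1),\dots,(i',1),(i',2),\dots,(i',j')\}$. Let $P_{k+1}$ be obtained from $P_k$ by a circular right shift of the entries on $L$: if the entries along $L$ in order are $a_1,\dots,a_m$, they are replaced by $a_m,a_1,\dots,a_{m-1}$ in order, and all other entries are unchanged. Let $J_{k+1}$ equal $J_k$ except that $(J_{k+1})_{ij}=1$. The process ends at $(P_n,J_n)$, and $\psi(P,J)=P_n$ (for $n=1$, $\psi(P,J)=P$). *)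

theory Defs
  imports "HOL-Library.Extended_Nat" "HOL-Library.FuncSet"
begin

text \<open>Rows and columns are numbered from 1, so row \<open>i\<close> of \<open>\<alpha>\<close> has length \<open>\<alpha> ! (i - 1)\<close>.\<close>

type_synonym cell = "nat \<times> nat"

definition composition :: "nat \<Rightarrow> nat list \<Rightarrow> bool" where
  "composition n \<alpha> \<longleftrightarrow> (\<forall>a \<in> set \<alpha>. 0 < a) \<and> sum_list \<alpha> = n"

definition diagram :: "nat list \<Rightarrow> cell set" where
  "diagram \<alpha> = {(i, j). 1 \<le> i \<and> i \<le> length \<alpha> \<and> 1 \<le> j \<and> j \<le> \<alpha> ! (i - 1)}"

fun hook :: "nat list \<Rightarrow> cell \<Rightarrow> cell set" where
  "hook \<alpha> (i, j) =
     (if j = 1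
      then {(i', j'). i \<le> i' \<and> i' \<le> length \<alpha> \<and> 1 \<le> j' \<and> j' \<le> \<alpha> ! (i' - 1)}
      else {(i', j'). i' = i \<and> j \<le> j' \<and> j' \<le> \<alpha> ! (i - 1)})"

definition hook_length :: "nat list \<Rightarrow> cell \<Rightarrow> nat" where
  "hook_length \<alpha> c = card (hook \<alpha> c)"

text \<open>
  Entries live in \<^typ>\<open>enat\<close> so that \<open>T\<^sub>i\<^sub>j = \<infinity>\<close> outside the diagram; this also makes a tableau
  determined by its entries inside the diagram.
\<close>

type_synonym tableau = "cell \<Rightarrow> enat"

definition is_tableau :: "nat list \<Rightarrow> tableau \<Rightarrow> bool" where
  "is_tableau \<alpha> T \<longleftrightarrow>
     (\<forall>c \<in> diagram \<alpha>. \<exists>m::nat. 1 \<le> m \<and> T c = enat m) \<and> (\<forall>c. c \<notin> diagram \<alpha> \<longrightarrow> T c = \<infinity>)"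

definition content_ones :: "nat \<Rightarrow> nat list \<Rightarrow> tableau \<Rightarrow> bool" where
  "content_ones n \<alpha> T \<longleftrightarrow> (\<forall>m \<in> {1..n}. \<exists>!c. c \<in> diagram \<alpha> \<and> T c = enat m)"

fun stable :: "tableau \<Rightarrow> cell \<Rightarrow> bool" where
  "stable T (i, j) \<longleftrightarrow>
     j > 1 \<and> T (i, j) \<le> T (i, j + 1) \<or>
     j = 1 \<and> T (i, j) < T (i + 1, j) \<and> T (i, j) \<le> T (i, j + 1)"

definition tableaux_ones :: "nat \<Rightarrow> nat list \<Rightarrow> tableau set" where
  "tableaux_ones n \<alpha> = {T. is_tableau \<alpha> T \<and> content_ones n \<alpha> T}"

definition standard_immaculate :: "nat \<Rightarrow> nat list \<Rightarrow> tableau set" where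
  "standard_immaculate n \<alpha> = {T \<in> tableaux_ones n \<alpha>. \<forall>c \<in> diagram \<alpha>. stable T c}"

text \<open>The extensional function space makes a hook tableau determined by its entries.\<close>

definition hook_tableaux :: "nat list \<Rightarrow> (cell \<Rightarrow> nat) set" where
  "hook_tableaux \<alpha> = (\<Pi>\<^sub>E c \<in> diagram \<alpha>. {1..hook_length \<alpha> c})"

fun cell_le :: "cell \<Rightarrow> cell \<Rightarrow> bool" where
  "cell_le (i, j) (i', j') \<longleftrightarrow> j > j' \<or> j = j' \<and> i \<ge> i'"

definition cell_less :: "cell \<Rightarrow> cell \<Rightarrow> bool" where
  "cell_less c d \<longleftrightarrow> cell_le c d \<and> \<not> cell_le d c"

lemma linorder_cell: "class.linorder cell_le cell_less"
  by unfold_locales (auto simp: cell_less_def)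

text \<open>\<open>ordered_cell \<alpha> m\<close> is the cell \<open>c\<^sub>m\<close>, counted from 1.\<close>

definition ordered_cell :: "nat list \<Rightarrow> nat \<Rightarrow> cell" where
  "ordered_cell \<alpha> m = linorder.sorted_list_of_set cell_le (diagram \<alpha>) ! (m - 1)"

definition row_reading :: "nat list \<Rightarrow> cell list" where
  "row_reading \<alpha> =
     concat (map (\<lambda>i. map (\<lambda>j. (i, j)) [1..<\<alpha> ! (i - 1) + 1]) [1..<length \<alpha> + 1])"

definition hook_reading :: "nat list \<Rightarrow> cell \<Rightarrow> cell list" where
  "hook_reading \<alpha> c = filter (\<lambda>d. d \<in> hook \<alpha> c) (row_reading \<alpha>)"

fun hook_path :: "cell \<Rightarrow> cell \<Rightarrow> cell list" where
  "hook_path (i, j) (i', j') =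
     (if i' = i then map (\<lambda>s. (i, s)) [j..<j' + 1]
      else map (\<lambda>r. (r, 1)) [i..<i' + 1] @ map (\<lambda>s. (i', s)) [2..<j' + 1])"

definition circular_right_shift :: "cell list \<Rightarrow> tableau \<Rightarrow> tableau" where
  "circular_right_shift L P =
     (let as = map P L; bs = last as # butlast as
      in (\<lambda>c. case map_of (zip L bs) c of None \<Rightarrow> P c | Some b \<Rightarrow> b))"

fun psi_step :: "nat list \<Rightarrow> cell \<Rightarrow> tableau \<times> (cell \<Rightarrow> nat) \<Rightarrow> tableau \<times> (cell \<Rightarrow> nat)" where
  "psi_step \<alpha> c (P, J) =
     (circular_right_shift (hook_path c (hook_reading \<alpha> c ! (J c - 1))) P, J(c := 1))"

text \<open>
  \<open>psi_iter \<alpha> PJ m\<close> is the pair \<open>(P\<^sub>k, J\<^sub>k)\<close> with \<open>k = m + 1\<close>; the step from \<open>k\<close> to \<open>k + 1\<close> treats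
  the cell \<open>c\<close> with index \<open>n + 1 - k = n - m\<close>, where \<open>n = sum_list \<alpha>\<close>.
\<close>

primrec psi_iter ::
  "nat list \<Rightarrow> tableau \<times> (cell \<Rightarrow> nat) \<Rightarrow> nat \<Rightarrow> tableau \<times> (cell \<Rightarrow> nat)" where
  "psi_iter \<alpha> PJ 0 = PJ"
| "psi_iter \<alpha> PJ (Suc m) = psi_step \<alpha> (ordered_cell \<alpha> (sum_list \<alpha> - m)) (psi_iter \<alpha> PJ m)"

definition psi :: "nat list \<Rightarrow> tableau \<times> (cell \<Rightarrow> nat) \<Rightarrow> tableau" where
  "psi \<alpha> PJ = fst (psi_iter \<alpha> PJ (sum_list \<alpha> - 1))"

end

theory Submission
  imports Defs "HOL-Combinatorics.Cycles"
begin

text \<open>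
  The diagram is a rooted tree: the children of a cell \<open>(i, 1)\<close> in the first column are
  \<open>(i, 2)\<close> and \<open>(i + 1, 1)\<close>, and the only child of a cell \<open>(i, j)\<close> with \<open>j > 1\<close> is
  \<open>(i, j + 1)\<close>, as far as these cells belong to the diagram. The hook of a cell is the set of its
  descendants, the path \<open>L\<close> of the definition of \<open>\<psi>\<close> is the unique downward path to the chosen
  descendant, and an entry is stable iff it is smaller than the entries at all children. So
  a standard immaculate tableau is an increasing labelling of a tree, and the theorem is a
  bijective form of the hook length formula for trees.

  The heart of the matter is a single step, \<open>bij_betw_rotate_path\<close>. Let \<open>F\<close> be a set of nodes
  closed under taking children, and let \<open>c\<close> be a node outside \<open>F\<close> all of whose children lie in
  \<open>F\<close>. Rotating the entries along a downward path from \<open>c\<close> turns a labelling that is stable on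
  \<open>insert c F\<close> into one that is stable on \<open>F\<close>. The path can be read off the result: it is
  the path along which the new entry \<open>x\<close> of \<open>c\<close> would sink when it is inserted into the stable part, that
  is, the path that always continues to the child with the smallest entry, as long as this
  entry is less than \<open>x\<close> (\<open>below_children_rotated_iff\<close>). Each labelling that is stable on \<open>F\<close> has
  exactly one such path (\<open>insertion_path_exists\<close>, \<open>insertion_path_unique\<close>), so the step is
  a bijection between pairs (labelling stable on \<open>insert c F\<close>, path from \<open>c\<close>) and labellings
  stable on \<open>F\<close>.

  Each step of \<open>\<psi>\<close> has this form, with \<open>F\<close> the set of cells that precede \<open>c\<close> in the total
  order, because children precede their parents. The value of \<open>J\<close> at \<open>c\<close> encodes the path, and it
  is used up by the step: it becomes 1. After the last step only the smallest cell
  may still be required to be stable, which is no condition on a leaf, and \<open>J\<close> is constantly 1.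
\<close>

section \<open>Rotating the entries along a list\<close>

lemma cycle_of_list_nth:
  assumes "distinct L" "Suc k < length L"
  shows "cycle_of_list L (L ! k) = L ! Suc k"
proof -
  have "map (cycle_of_list L) L = rotate1 L"
    using cyclic_rotation[OF assms(1), of 1] by simp
  then have "cycle_of_list L (L ! k) = rotate1 L ! k"
    using assms(2) by (metis Suc_lessD nth_map)
  then show ?thesis
    using assms(2) by (simp add: nth_rotate1)
qed

lemma cycle_of_list_last:
  assumes "distinct L" "L \<noteq> []"
  shows "cycle_of_list L (last L) = hd L"
proof -
  have "map (cycle_of_list L) L = rotate1 L"
    using cyclic_rotation[OF assms(1), of 1] by simp
  then have "cycle_of_list L (last L) = last (rotate1 L)"
    using assms(2) by (metis last_map)
  then show ?thesis
    using assms(2) by (cases L) auto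
qed

text \<open>
  Composing with the inverse of a cycle makes the circular shift a permutation of
  the entries, so that shifts are visibly invertible and preserve the content.
\<close>

lemma circular_right_shift_eq:
  assumes "distinct L" "L \<noteq> []"
  shows "circular_right_shift L P = P \<circ> inv (cycle_of_list L)"
proof -
  let ?as = "map P L" and ?\<sigma> = "cycle_of_list L"
  let ?bs = "last ?as # butlast ?as"
  have len: "length ?bs = length L"
    using assms(2) by simp
  have shift_nth: "circular_right_shift L P (L ! k) = ?bs ! k" if "k < length L" for k
    using map_of_zip_nth[of L ?bs k] assms(1) len that
    by (simp add: circular_right_shift_def Let_def)
  have "circular_right_shift L P (?\<sigma> v) = P v" for v
  proof (cases "v \<in> set L")
    case False
    then have "map_of (zip L ?bs) v = None"
      using len by (simp add: map_of_zip_is_None)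
    then show ?thesis
      using id_outside_supp[OF False] by (simp add: circular_right_shift_def Let_def)
  next
    case True
    then obtain k where k: "k < length L" "v = L ! k"
      by (metis in_set_conv_nth)
    show ?thesis
    proof (cases "Suc k < length L")
      case True
      then show ?thesis
        using shift_nth[OF True] k cycle_of_list_nth[OF assms(1) True]
        by (simp add: nth_butlast)
    next
      case False
      then have "v = last L"
        using k assms(2) by (metis Suc_lessI diff_Suc_1 last_conv_nth)
      then show ?thesis
        using cycle_of_list_last[OF assms] shift_nth[of 0] assms(2)
        by (simp add: hd_conv_nth last_map)
    qed
  qed
  then have "circular_right_shift L P \<circ> ?\<sigma> \<circ> inv ?\<sigma> = P \<circ> inv ?\<sigma>"
    by (simp add: fun_eq_iff)
  then show ?thesis
    by (simp only: comp_assoc permutes_inv_o(1)[OF cycle_permutes[of L]] comp_id)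
qed

section \<open>Increasing labellings of forests\<close>

locale finite_forest =
  fixes D :: "'a set" and E :: "('a \<times> 'a) set"
  assumes finite_nodes: "finite D"
    and edges_subset: "E \<subseteq> D \<times> D"
    and acyclic_edges: "acyclic E"
    and unique_parent: "single_valued (E\<inverse>)"
begin

definition paths_from :: "'a \<Rightarrow> 'a list set" where
  "paths_from c = {L. L \<noteq> [] \<and> hd L = c \<and> successively (\<lambda>u v. (u, v) \<in> E) L}"

definition below_children :: "('a \<Rightarrow> 'b::linorder) \<Rightarrow> 'a \<Rightarrow> bool" where
  "below_children T v \<longleftrightarrow> (\<forall>w. (v, w) \<in> E \<longrightarrow> T v < T w)"

text \<open>
  The path along which a new entry \<open>x\<close>, placed at the first node of \<open>L\<close>, sinks by exchanges with the
  smallest entry of a child until it exceeds none of the entries at the children. The last condition is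
  only \<open>x \<le> T w\<close>: with the negation of \<open>T v < x\<close> as stopping rule, an insertion path
  exists for every \<open>x\<close>, even for one that occurs among the labels.
\<close>

definition insertion_path :: "('a \<Rightarrow> 'b::linorder) \<Rightarrow> 'b \<Rightarrow> 'a list \<Rightarrow> bool" where
  "insertion_path T x L \<longleftrightarrow>
     successively (\<lambda>u v. (u, v) \<in> E \<and> T v < x \<and> (\<forall>w. (u, w) \<in> E \<longrightarrow> T v \<le> T w)) L \<and>
     (\<forall>w. (last L, w) \<in> E \<longrightarrow> x \<le> T w)"

lemma finite_edges: "finite E"
  using finite_subset[OF edges_subset] finite_nodes by simp

lemma parent_eq: "(u, w) \<in> E \<Longrightarrow> (v, w) \<in> E \<Longrightarrow> u = v"
  using unique_parent by (auto simp: single_valued_def)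

lemma path_nth_trancl:
  assumes "successively (\<lambda>u v. (u, v) \<in> E) L" "i < j" "j < length L"
  shows "(L ! i, L ! j) \<in> E\<^sup>+"
proof -
  have "successively (\<lambda>u v. (u, v) \<in> E\<^sup>+) L"
    using assms(1) by (rule successively_mono) auto
  moreover have "transp (\<lambda>u v. (u, v) \<in> E\<^sup>+)"
    by (auto intro: transpI)
  ultimately have "sorted_wrt (\<lambda>u v. (u, v) \<in> E\<^sup>+) L"
    by (simp add: successively_conv_sorted_wrt)
  with assms(2,3) show ?thesis
    by (simp add: sorted_wrt_iff_nth_less)
qed

lemma no_back_edge:
  assumes "successively (\<lambda>u v. (u, v) \<in> E) L" "k < length L"
  shows "(L ! k, L ! 0) \<notin> E"
proof
  assume loop: "(L ! k, L ! 0) \<in> E"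
  have "(L ! 0, L ! k) \<in> E\<^sup>*"
    using path_nth_trancl[OF assms(1), of 0 k] assms(2) by (cases "k = 0") auto
  with loop have "(L ! 0, L ! 0) \<in> E\<^sup>+"
    by (meson rtrancl_into_trancl1)
  with acyclic_edges show False
    by (auto simp: acyclic_def)
qed

lemma distinct_path:
  assumes "successively (\<lambda>u v. (u, v) \<in> E) L"
  shows "distinct L"
proof -
  have "L ! i \<noteq> L ! j" if "i < j" "j < length L" for i j
    using path_nth_trancl[OF assms that] acyclic_edges unfolding acyclic_def by metis
  then show ?thesis
    unfolding distinct_conv_nth by (metis nat_neq_iff)
qed

text \<open>
  As a node has one parent only and an edge back to the first node would close a cycle, an edge between two
  nodes of a path is an edge of the path. For the same reason (next lemma) an edge from outside can enter
  the path only at its first node. This confines the effect of a rotation on an edge inside a set that is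
  closed under children to three cases: the edge lies on the path, leaves it, or avoids it.
\<close>

lemma child_of_path_node:
  assumes path: "successively (\<lambda>u v. (u, v) \<in> E) L" and k: "k < length L"
    and edge: "(L ! k, w) \<in> E" and w: "w \<in> set L"
  shows "Suc k < length L \<and> w = L ! Suc k"
proof -
  obtain j where j: "j < length L" "w = L ! j"
    using w by (metis in_set_conv_nth)
  have "j \<noteq> 0"
    using no_back_edge[OF path k] edge j by metis
  then obtain i where i: "j = Suc i"
    using not0_implies_Suc by blast
  have "(L ! i, w) \<in> E"
    using successively_nth[OF path, of i] i j by simp
  then have "L ! i = L ! k"
    using edge parent_eq by blast
  then have "i = k"
    using distinct_path[OF path] i j k by (simp add: nth_eq_iff_index_eq)
  with i j show ?thesis by simp
qed

lemma child_off_path: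
  assumes path: "successively (\<lambda>u v. (u, v) \<in> E) L" and "L \<noteq> []"
    and v: "v \<notin> set L" and edge: "(v, w) \<in> E" and w: "w \<noteq> hd L"
  shows "w \<notin> set L"
proof
  assume "w \<in> set L"
  then obtain j where j: "j < length L" "w = L ! j"
    by (metis in_set_conv_nth)
  have "j \<noteq> 0"
    using w j \<open>L \<noteq> []\<close> by (metis hd_conv_nth)
  then obtain i where i: "j = Suc i"
    using not0_implies_Suc by blast
  have "(L ! i, w) \<in> E"
    using successively_nth[OF path, of i] i j by simp
  then have "L ! i = v"
    using edge parent_eq by blast
  with v i j show False by auto
qed

lemma path_tail_in_closed_set:
  assumes "successively (\<lambda>u v. (u, v) \<in> E) L" "L \<noteq> []" "hd L = c"
    and closed: "E `` insert c F \<subseteq> F" and "Suc k < length L"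
  shows "L ! Suc k \<in> F"
  using assms(5)
proof (induction k)
  case 0
  then show ?case
    using successively_nth[OF assms(1), of 0] assms(2,3) closed by (auto simp: hd_conv_nth)
next
  case (Suc k)
  then show ?case
    using successively_nth[OF assms(1), of "Suc k"] closed by auto
qed

lemma path_nodes:
  assumes "c \<in> D" "L \<in> paths_from c"
  shows "set L \<subseteq> D"
proof
  fix v assume "v \<in> set L"
  then obtain j where j: "j < length L" "v = L ! j"
    by (metis in_set_conv_nth)
  have "E `` insert c D \<subseteq> D"
    using edges_subset by auto
  then show "v \<in> D"
    using path_tail_in_closed_set[of L c D] assms j
    by (cases j) (auto simp: paths_from_def hd_conv_nth)
qed

text \<open>
  Write \<open>v\<^sub>0 = c, v\<^sub>1, ..., v\<^sub>m\<close> for the path and \<open>S\<close> for the labelling before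
  the rotation, so that \<open>T v\<^sub>0 = S v\<^sub>m\<close>, \<open>T v\<^sub>k\<^sub>+\<^sub>1 = S v\<^sub>k\<close>, and \<open>S\<close> and
  \<open>T\<close> agree elsewhere. If \<open>S\<close> increases down the tree, then \<open>T v\<^sub>k\<^sub>+\<^sub>1 = S v\<^sub>k\<close> is less
  than \<open>S v\<^sub>m = T c\<close> and than the entries at the siblings of \<open>v\<^sub>k\<^sub>+\<^sub>1\<close>, which have not moved,
  and \<open>T c = S v\<^sub>m\<close> is less than the entries at the children of \<open>v\<^sub>m\<close>. So the path is an
  insertion path of \<open>T\<close>. Conversely these inequalities are what the entries moved
  back up the path need in order to be smaller than the entries at their new children.
\<close>

lemma below_children_rotated_iff:
  fixes T :: "'a \<Rightarrow> 'b::linorder"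
  assumes L: "L \<in> paths_from c" and inj: "inj_on T D"
    and c: "c \<in> D" "c \<notin> F" and F: "F \<subseteq> D" and closed: "E `` insert c F \<subseteq> F"
  shows "(\<forall>v \<in> insert c F. below_children (T \<circ> cycle_of_list L) v) \<longleftrightarrow>
         (\<forall>v \<in> F. below_children T v) \<and> insertion_path T (T c) L"
proof -
  define S where "S = T \<circ> cycle_of_list L"
  have path: "successively (\<lambda>u v. (u, v) \<in> E) L" and ne: "L \<noteq> []" and hd: "hd L = c"
    using L by (auto simp: paths_from_def)
  note dist = distinct_path[OF path]
  have hd0: "L ! 0 = c"
    using hd ne by (simp add: hd_conv_nth)
  have last: "last L = L ! (length L - 1)" and len: "length L > 0"
    using ne by (auto simp: last_conv_nth)
  have S_nth: "S (L ! k) = T (L ! Suc k)" if "Suc k < length L" for k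
    using cycle_of_list_nth[OF dist that] by (simp add: S_def)
  have S_last: "S (last L) = T c"
    using cycle_of_list_last[OF dist ne] hd by (simp add: S_def)
  have S_off: "S v = T v" if "v \<notin> set L" for v
    using id_outside_supp[OF that] by (simp add: S_def)
  note tail = path_tail_in_closed_set[OF path ne hd closed]
  have in_F: "L ! k \<in> insert c F" if "k < length L" for k
    using tail hd0 that by (cases k) auto
  note child = child_of_path_node[OF path]
  have off: "w \<notin> set L" if "v \<in> F" "v \<notin> set L" "(v, w) \<in> E" for v w
    using child_off_path[OF path ne that(2,3)] hd closed c that by auto
  have strict: "T v < T w" if "T v \<le> T w" "v \<in> D" "w \<in> D" "v \<noteq> w" for v w
    using that inj by (auto simp: inj_on_def order.order_iff_strict)
  have edgeD: "v \<in> D \<and> w \<in> D" if "(v, w) \<in> E" for v w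
    using that edges_subset by auto
  have nth_E: "(L ! k, L ! Suc k) \<in> E" if "Suc k < length L" for k
    using successively_nth[OF path that] .
  have path_iff: "insertion_path T (T c) L \<longleftrightarrow>
      (\<forall>k. Suc k < length L \<longrightarrow> T (L ! Suc k) < T c \<and> (\<forall>w. (L ! k, w) \<in> E \<longrightarrow> T (L ! Suc k) \<le> T w)) \<and>
      (\<forall>w. (last L, w) \<in> E \<longrightarrow> T c \<le> T w)"
    using nth_E by (auto simp: insertion_path_def successively_conv_nth)
  have "(\<forall>v \<in> insert c F. below_children S v) \<longleftrightarrow>
         (\<forall>v \<in> F. below_children T v) \<and> insertion_path T (T c) L"
  proof (intro iffI conjI ballI)
    assume S: "\<forall>v \<in> insert c F. below_children S v"
    have S_less: "S v < S w" if "v \<in> insert c F" "(v, w) \<in> E" for v w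
      using S that by (auto simp: below_children_def)
    have "successively (\<lambda>u v. S u < S v) L"
      unfolding successively_conv_nth using S_less in_F nth_E by auto
    then have "sorted_wrt (\<lambda>u v. S u < S v) L"
      by (subst (asm) successively_conv_sorted_wrt) (auto intro!: transpI)
    then have S_mono: "S (L ! k) < S (last L)" if "Suc k < length L" for k
      using that unfolding last by (simp add: sorted_wrt_iff_nth_less)
    show "below_children T v" if v: "v \<in> F" for v
      unfolding below_children_def
    proof (intro allI impI)
      fix w assume vw: "(v, w) \<in> E"
      show "T v < T w"
      proof (cases "v \<in> set L")
        case False
        then show ?thesis
          using off[OF v False vw] S_off S_less[of v w] v vw by simp
      next
        case True
        then obtain j where j: "j < length L" "v = L ! j"
          by (metis in_set_conv_nth)
        with v c hd0 obtain k where k: "j = Suc k"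
          by (metis not0_implies_Suc)
        have Tv: "T v = S (L ! k)" and kv: "S (L ! k) < S v"
          using S_nth[of k] S_less[OF in_F nth_E, of k] j k by auto
        show ?thesis
        proof (cases "w \<in> set L")
          case True
          then show ?thesis
            using child[of j w] S_nth[of j] vw j Tv kv by simp
        next
          case False
          then show ?thesis
            using Tv kv S_off[OF False] S_less[of v w] v vw by simp
        qed
      qed
    qed
    show "insertion_path T (T c) L"
      unfolding path_iff
    proof (intro conjI allI impI)
      fix k assume k: "Suc k < length L"
      show "T (L ! Suc k) < T c"
        using S_nth[OF k] S_mono[OF k] S_last by simp
      fix w assume w: "(L ! k, w) \<in> E"
      show "T (L ! Suc k) \<le> T w"
      proof (cases "w \<in> set L")
        case True
        then show ?thesis using child[of k w] w k by simp
      next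
        case False
        then show ?thesis
          using S_less[OF in_F w] S_off[OF False] S_nth[OF k] k by simp
      qed
    next
      fix w assume w: "(last L, w) \<in> E"
      then have "w \<notin> set L"
        using child[of "length L - 1" w] len last by auto
      then show "T c \<le> T w"
        using S_less[OF in_F, of "length L - 1" w] w S_off S_last len last by simp
    qed
  next
    fix v assume asm: "(\<forall>v \<in> F. below_children T v) \<and> insertion_path T (T c) L"
      and v: "v \<in> insert c F"
    have T_less: "T v < T w" if "v \<in> F" "(v, w) \<in> E" for v w
      using asm that by (auto simp: below_children_def)
    show "below_children S v"
      unfolding below_children_def
    proof (intro allI impI)
      fix w assume vw: "(v, w) \<in> E"
      show "S v < S w"
      proof (cases "v \<in> set L")
        case False
        then have "v \<in> F"
          using v ne hd by (metis hd_in_set insertE)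
        then show ?thesis
          using off[OF _ False vw] S_off False T_less vw by simp
      next
        case True
        then obtain k where k: "k < length L" "v = L ! k"
          by (metis in_set_conv_nth)
        show ?thesis
        proof (cases "Suc k < length L")
          case True
          have Sv: "S v = T (L ! Suc k)"
            using S_nth[OF True] k by simp
          show ?thesis
          proof (cases "w \<in> set L")
            case w: True
            have w_eq: "w = L ! Suc k"
              using child[of k w] vw k w by simp
            show ?thesis
            proof (cases "Suc (Suc k) < length L")
              case True
              then show ?thesis
                using Sv w_eq S_nth[OF True] T_less[OF tail nth_E, of k] by simp
            next
              case False
              then have "w = last L"
                using True w_eq last by (metis Suc_lessI diff_Suc_1)
              then show ?thesis
                using Sv S_last asm True unfolding path_iff by simp
            qed
          next
            case False
            then have "T (L ! Suc k) < T w"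
              using asm True vw k edgeD nth_E[OF True] unfolding path_iff
              by (intro strict) (auto simp: in_set_conv_nth)
            then show ?thesis
              using Sv S_off[OF False] by simp
          qed
        next
          case False
          then have v_last: "v = last L"
            using k last by (metis Suc_lessI diff_Suc_1)
          have w: "w \<notin> set L"
            using child[of k w] vw k False by auto
          then have "T c < T w"
            using asm v_last vw edgeD c hd_in_set[OF ne] hd unfolding path_iff
            by (intro strict) auto
          then show ?thesis
            using S_off[OF w] S_last v_last by simp
        qed
      qed
    qed
  qed
  then show ?thesis by (simp only: S_def)
qed

lemma insertion_path_exists: "\<exists>L. L \<in> paths_from v \<and> insertion_path T x L"
proof (induction v rule: wf_induct_rule[OF finite_acyclic_wf_converse[OF finite_edges acyclic_edges]])
  case (1 v)
  show ?case
  proof (cases "\<forall>w. (v, w) \<in> E \<longrightarrow> x \<le> T w")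
    case True
    then show ?thesis
      by (intro exI[of _ "[v]"]) (simp add: paths_from_def insertion_path_def)
  next
    case False
    then obtain w0 where w0: "(v, w0) \<in> E" "T w0 < x"
      by auto
    let ?C = "E `` {v}"
    have fin: "finite (T ` ?C)" and ne: "T ` ?C \<noteq> {}"
      using finite_edges w0 by (auto intro: finite_Image)
    from Min_in[OF fin ne] obtain u where u: "(v, u) \<in> E" "T u = Min (T ` ?C)"
      by force
    have min: "T u \<le> T w" if "(v, w) \<in> E" for w
      using u(2) Min_le[OF fin] that by auto
    obtain L where L: "L \<in> paths_from u" "insertion_path T x L"
      using 1[of u] u by auto
    have "T u < x" using min[OF w0(1)] w0(2) by simp
    then show ?thesis
      using L u min
      by (intro exI[of _ "v # L"])
        (auto simp: paths_from_def insertion_path_def successively_Cons)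
  qed
qed

text \<open>
  The stopping rule and the rule for continuing exclude each other, and distinct labels leave no
  choice of the smallest child.
\<close>

lemma insertion_path_unique:
  assumes inj: "inj_on T D"
    and "L \<in> paths_from v" "insertion_path T x L" "M \<in> paths_from v" "insertion_path T x M"
  shows "L = M"
  using assms(2-)
proof (induction L arbitrary: v M)
  case Nil
  then show ?case by (simp add: paths_from_def)
next
  case (Cons a L)
  from Cons.prems obtain M' where M: "M = a # M'" and a: "a = v"
    by (cases M) (auto simp: paths_from_def)
  have step: "L' = [] \<and> (\<forall>w. (v, w) \<in> E \<longrightarrow> x \<le> T w) \<or>
      L' \<noteq> [] \<and> L' \<in> paths_from (hd L') \<and> insertion_path T x L' \<and> (v, hd L') \<in> E \<and> T (hd L') < x \<and>
      (\<forall>w. (v, w) \<in> E \<longrightarrow> T (hd L') \<le> T w)"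
    if "v # L' \<in> paths_from v" "insertion_path T x (v # L')" for L'
    using that by (cases "L' = []") (auto simp: paths_from_def insertion_path_def successively_Cons)
  note L = step[of L] and M' = step[of M']
  show ?case
  proof (cases "L = [] \<or> M' = []")
    case True
    then show ?thesis
      using L M' Cons.prems M a by (auto dest!: leD)
  next
    case False
    have "T (hd L) = T (hd M')" "hd L \<in> D" "hd M' \<in> D"
      using False L M' Cons.prems M a edges_subset by (auto intro: order.antisym)
    then have "hd L = hd M'"
      using inj by (auto dest: inj_onD)
    then show ?thesis
      using Cons.IH[of "hd L" M'] False L M' Cons.prems M a by auto
  qed
qed

definition increasing_labelings :: "('a \<Rightarrow> 'b::linorder) set \<Rightarrow> 'a set \<Rightarrow> ('a \<Rightarrow> 'b) set" where
  "increasing_labelings X F = {T \<in> X. \<forall>v \<in> F. below_children T v}"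

text \<open>
  The inverse map rotates a labelling back along the insertion path of its entry at \<open>c\<close>.
\<close>

theorem bij_betw_rotate_path:
  fixes X :: "('a \<Rightarrow> 'b::linorder) set"
  assumes inj: "\<And>T. T \<in> X \<Longrightarrow> inj_on T D"
    and perm: "\<And>T p. T \<in> X \<Longrightarrow> p permutes D \<Longrightarrow> T \<circ> p \<in> X"
    and c: "c \<in> D" "c \<notin> F" and F: "F \<subseteq> D" and closed: "E `` insert c F \<subseteq> F"
  shows "bij_betw (\<lambda>(T, L). T \<circ> inv (cycle_of_list L))
           (increasing_labelings X (insert c F) \<times> paths_from c) (increasing_labelings X F)"
proof -
  define path where "path T = (THE L. L \<in> paths_from c \<and> insertion_path T (T c) L)" for T :: "'a \<Rightarrow> 'b"
  have path: "path T \<in> paths_from c \<and> insertion_path T (T c) (path T)" if "T \<in> X" for T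
    unfolding path_def
    by (rule theI') (use insertion_path_exists insertion_path_unique[OF inj[OF that]] in blast)
  have path_eq: "path T = L" if "T \<in> X" "L \<in> paths_from c" "insertion_path T (T c) L" for T L
    using insertion_path_unique[OF inj[OF that(1)]] path[OF that(1)] that by blast
  have cyc: "cycle_of_list L permutes D" if "L \<in> paths_from c" for L
    using permutes_subset[OF cycle_permutes path_nodes[OF c(1) that]] .
  have inv_cancel: "T \<circ> inv (cycle_of_list L) \<circ> cycle_of_list L = T"
    "T \<circ> cycle_of_list L \<circ> inv (cycle_of_list L) = T" for T :: "'a \<Rightarrow> 'b" and L
    using permutes_inv_o[OF cycle_permutes[of L]] by (simp_all add: comp_assoc)
  have key: "T \<circ> inv (cycle_of_list L) \<in> increasing_labelings X F \<and>
      path (T \<circ> inv (cycle_of_list L)) = L"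
    if "T \<in> increasing_labelings X (insert c F)" "L \<in> paths_from c" for T L
  proof -
    let ?S = "T \<circ> inv (cycle_of_list L)"
    have S: "?S \<in> X"
      using that perm permutes_inv[OF cyc] by (auto simp: increasing_labelings_def)
    then show ?thesis
      using below_children_rotated_iff[OF that(2) inj[OF S] c F closed] path_eq[OF S that(2)] that
      by (auto simp: increasing_labelings_def inv_cancel)
  qed
  show ?thesis
  proof (rule bij_betw_byWitness[where f' = "\<lambda>T. (T \<circ> cycle_of_list (path T), path T)"])
    show "\<forall>a \<in> increasing_labelings X (insert c F) \<times> paths_from c.
       (\<lambda>T. (T \<circ> cycle_of_list (path T), path T)) ((\<lambda>(T, L). T \<circ> inv (cycle_of_list L)) a) = a"
      using key by (auto simp: inv_cancel)
    show "\<forall>T \<in> increasing_labelings X F.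
       (\<lambda>(T, L). T \<circ> inv (cycle_of_list L)) (T \<circ> cycle_of_list (path T), path T) = T"
      by (simp add: inv_cancel)
    show "(\<lambda>(T, L). T \<circ> inv (cycle_of_list L)) ` (increasing_labelings X (insert c F) \<times> paths_from c)
       \<subseteq> increasing_labelings X F"
      using key by auto
    show "(\<lambda>T. (T \<circ> cycle_of_list (path T), path T)) ` increasing_labelings X F
       \<subseteq> increasing_labelings X (insert c F) \<times> paths_from c"
    proof
      fix y assume "y \<in> (\<lambda>T. (T \<circ> cycle_of_list (path T), path T)) ` increasing_labelings X F"
      then obtain T where T: "T \<in> increasing_labelings X F"
        and y: "y = (T \<circ> cycle_of_list (path T), path T)" by auto
      have X: "T \<in> X" using T by (simp add: increasing_labelings_def)
      have "T \<circ> cycle_of_list (path T) \<in> increasing_labelings X (insert c F)"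
        using below_children_rotated_iff[OF _ inj[OF X] c F closed] path[OF X] T perm[OF X cyc]
        by (simp add: increasing_labelings_def)
      with path[OF X] y show "y \<in> increasing_labelings X (insert c F) \<times> paths_from c" by simp
    qed
  qed
qed

end

section \<open>The diagram as a rooted tree\<close>

definition tree_edges :: "nat list \<Rightarrow> (cell \<times> cell) set" where
  "tree_edges \<alpha> = {((i, j), (i', j')). (i, j) \<in> diagram \<alpha> \<and> (i', j') \<in> diagram \<alpha> \<and>
     (i' = i \<and> j' = Suc j \<or> j = 1 \<and> j' = 1 \<and> i' = Suc i)}"

lemma set_row_reading: "set (row_reading \<alpha>) = diagram \<alpha>"
  by (auto simp: row_reading_def diagram_def image_iff simp del: upt_Suc)

lemma finite_diagram: "finite (diagram \<alpha>)"
  by (metis set_row_reading List.finite_set)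

lemma length_row_reading: "length (row_reading \<alpha>) = sum_list \<alpha>"
proof -
  have "map (\<lambda>i. \<alpha> ! (i - 1)) [1..<length \<alpha> + 1] = \<alpha>"
    by (rule nth_equalityI) (auto simp del: upt_Suc)
  then show ?thesis
    by (simp add: row_reading_def length_concat comp_def del: upt_Suc)
qed

lemma distinct_row_reading: "distinct (row_reading \<alpha>)"
proof -
  have "distinct (concat (map (\<lambda>i. map (\<lambda>j. (i, j)) [1..<f i]) [a..<b]))"
    for f :: "nat \<Rightarrow> nat" and a b :: nat
    by (induction b) (auto simp: distinct_map inj_on_def)
  then show ?thesis by (simp add: row_reading_def del: upt_Suc)
qed

lemma card_diagram: "card (diagram \<alpha>) = sum_list \<alpha>"
  by (metis distinct_card distinct_row_reading length_row_reading set_row_reading)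

lemma finite_forest_diagram: "finite_forest (diagram \<alpha>) (tree_edges \<alpha>)"
proof
  show "finite (diagram \<alpha>)" by (rule finite_diagram)
  show "tree_edges \<alpha> \<subseteq> diagram \<alpha> \<times> diagram \<alpha>"
    by (auto simp: tree_edges_def)
  have "(tree_edges \<alpha>)\<inverse> \<subseteq> (measure (\<lambda>(i, j). i + j))\<inverse>"
    by (auto simp: tree_edges_def)
  then show "acyclic (tree_edges \<alpha>)"
    by (metis acyclic_subset converse_mono wf_acyclic wf_measure)
  show "single_valued ((tree_edges \<alpha>)\<inverse>)"
    by (auto simp: single_valued_def tree_edges_def diagram_def)
qed

interpretation diagram: finite_forest "diagram \<alpha>" "tree_edges \<alpha>" for \<alpha>
  by (rule finite_forest_diagram)

lemma hook_subset_diagram: "c \<in> diagram \<alpha> \<Longrightarrow> hook \<alpha> c \<subseteq> diagram \<alpha>"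
  by (cases c) (auto simp: diagram_def split: if_splits)

lemma root_in_hook: "c \<in> diagram \<alpha> \<Longrightarrow> c \<in> hook \<alpha> c"
  by (cases c) (auto simp: diagram_def)

lemma hook_path_self: "hook_path c c = [c]"
  by (cases c) simp

text \<open>
  The hook is closed under taking children, and hook paths grow by single edges.
\<close>

lemma hook_path_child:
  assumes "c \<in> diagram \<alpha>" "d \<in> hook \<alpha> c" "(d, w) \<in> tree_edges \<alpha>"
  shows "w \<in> hook \<alpha> c \<and> hook_path c w = hook_path c d @ [w]"
proof -
  obtain i j where c: "c = (i, j)" by force
  obtain k l where d: "d = (k, l)" by force
  obtain k' l' where w: "w = (k', l')" by force
  show ?thesis
    using assms unfolding c d w
    by (auto simp: tree_edges_def diagram_def upt_conv_Cons numeral_2_eq_2 split: if_splits)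
qed

lemma hook_parent:
  assumes "composition n \<alpha>" "c \<in> diagram \<alpha>" "d \<in> hook \<alpha> c" "d \<noteq> c"
  obtains p where "p \<in> hook \<alpha> c" "(p, d) \<in> tree_edges \<alpha>"
proof -
  obtain i j where c: "c = (i, j)" by force
  obtain k l where d: "d = (k, l)" by force
  have pos: "\<alpha> ! r \<ge> 1" if "r < length \<alpha>" for r
    using assms(1) that by (auto simp: composition_def Suc_le_eq)
  show thesis
  proof (cases "l = 1")
    case True
    have "(k - 1, 1) \<in> hook \<alpha> c \<and> ((k - 1, 1), d) \<in> tree_edges \<alpha>"
      using assms(2-) pos[of "k - 1 - 1"] True unfolding c d
      by (auto simp: tree_edges_def diagram_def split: if_splits)
    then show thesis using that by blast
  next
    case False
    have "(k, l - 1) \<in> hook \<alpha> c \<and> ((k, l - 1), d) \<in> tree_edges \<alpha>"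
      using assms(2-) False unfolding c d
      by (auto simp: tree_edges_def diagram_def split: if_splits)
    then show thesis using that by blast
  qed
qed

text \<open>
  The hook of \<open>c\<close> consists of the descendants of \<open>c\<close>. Positivity of the parts enters here:
  without it, the first column might be interrupted and cells of the hook cut off from \<open>c\<close>.
\<close>

lemma bij_betw_hook_path:
  assumes "composition n \<alpha>" "c \<in> diagram \<alpha>"
  shows "bij_betw (hook_path c) (hook \<alpha> c) (diagram.paths_from \<alpha> c)"
proof (rule bij_betw_byWitness[where f' = last])
  have into: "hook_path c d \<in> diagram.paths_from \<alpha> c \<and> last (hook_path c d) = d"
    if "d \<in> hook \<alpha> c" for d
    using that
  proof (induction d rule: wf_induct_rule[OF finite_acyclic_wf[OF diagram.finite_edges diagram.acyclic_edges, of \<alpha>]])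
    case (1 d)
    show ?case
    proof (cases "d = c")
      case True
      then show ?thesis by (simp add: hook_path_self diagram.paths_from_def)
    next
      case False
      then obtain p where p: "p \<in> hook \<alpha> c" "(p, d) \<in> tree_edges \<alpha>"
        using hook_parent[OF assms 1(2)] by metis
      then show ?thesis
        using 1(1)[OF p(2,1)] hook_path_child[OF assms(2) p]
        by (auto simp: diagram.paths_from_def successively_append_iff)
    qed
  qed
  then show "\<forall>d \<in> hook \<alpha> c. last (hook_path c d) = d"
    and "hook_path c ` hook \<alpha> c \<subseteq> diagram.paths_from \<alpha> c" by auto
  have onto: "last L \<in> hook \<alpha> c \<and> hook_path c (last L) = L" if "L \<in> diagram.paths_from \<alpha> c" for L
    using that
  proof (induction L rule: rev_induct)
    case Nil
    then show ?case by (simp add: diagram.paths_from_def)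
  next
    case (snoc w L)
    show ?case
    proof (cases "L = []")
      case True
      then show ?thesis
        using snoc.prems root_in_hook[OF assms(2)]
        by (simp add: diagram.paths_from_def hook_path_self)
    next
      case False
      then have L: "L \<in> diagram.paths_from \<alpha> c" "(last L, w) \<in> tree_edges \<alpha>"
        using snoc.prems by (auto simp: diagram.paths_from_def successively_append_iff)
      then show ?thesis
        using snoc.IH[OF L(1)] hook_path_child[OF assms(2) _ L(2)] by simp
    qed
  qed
  then show "\<forall>L \<in> diagram.paths_from \<alpha> c. hook_path c (last L) = L"
    and "last ` diagram.paths_from \<alpha> c \<subseteq> hook \<alpha> c" by auto
qed

lemma bij_betw_hook_reading:
  assumes "c \<in> diagram \<alpha>"
  shows "bij_betw (\<lambda>r. hook_reading \<alpha> c ! (r - 1)) {1..hook_length \<alpha> c} (hook \<alpha> c)"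
proof -
  have set: "set (hook_reading \<alpha> c) = hook \<alpha> c"
    using hook_subset_diagram[OF assms] by (auto simp: hook_reading_def set_row_reading)
  have dist: "distinct (hook_reading \<alpha> c)"
    by (simp add: hook_reading_def distinct_row_reading)
  have len: "length (hook_reading \<alpha> c) = hook_length \<alpha> c"
    by (metis set dist distinct_card hook_length_def)
  have "bij_betw (\<lambda>r. r - 1) {1..hook_length \<alpha> c} {..<hook_length \<alpha> c}"
    by (rule bij_betw_byWitness[where f' = Suc]) auto
  from bij_betw_trans[OF this bij_betw_nth[OF dist _ set[symmetric], unfolded len, OF refl]]
  show ?thesis by (simp add: comp_def)
qed

section \<open>Tableaux as labellings\<close>

text \<open>
  The content is prescribed only for the values \<open>1, ..., n\<close>. As the diagram has exactly \<open>n\<close> cells,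
  counting shows that there are no further entries and no repetitions.
\<close>

lemma tableaux_ones_inj_on:
  assumes "composition n \<alpha>" "T \<in> tableaux_ones n \<alpha>"
  shows "inj_on T (diagram \<alpha>)"
proof -
  have sub: "enat ` {1..n} \<subseteq> T ` diagram \<alpha>"
    using assms(2) by (force simp: tableaux_ones_def content_ones_def)
  have "card (enat ` {1..n}) = n"
    by (simp add: card_image inj_on_def)
  then have "card (diagram \<alpha>) \<le> card (T ` diagram \<alpha>)"
    using card_mono[OF finite_imageI[OF finite_diagram] sub] assms(1) card_diagram[of \<alpha>]
    by (simp add: composition_def)
  then show ?thesis
    by (intro eq_card_imp_inj_on finite_diagram antisym card_image_le)
qed

lemma tableaux_ones_permute:
  assumes "T \<in> tableaux_ones n \<alpha>" "p permutes diagram \<alpha>"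
  shows "T \<circ> p \<in> tableaux_ones n \<alpha>"
proof -
  have mem: "p c \<in> diagram \<alpha> \<longleftrightarrow> c \<in> diagram \<alpha>" for c
    by (rule permutes_in_image[OF assms(2)])
  have "is_tableau \<alpha> (T \<circ> p)"
    unfolding is_tableau_def comp_apply
  proof (intro conjI ballI allI impI)
    have T: "is_tableau \<alpha> T"
      using assms(1) by (simp add: tableaux_ones_def)
    show "\<exists>m::nat. 1 \<le> m \<and> T (p c) = enat m" if "c \<in> diagram \<alpha>" for c
      using T mem[of c] that unfolding is_tableau_def by blast
    show "T (p c) = \<infinity>" if "c \<notin> diagram \<alpha>" for c
      using T mem[of c] that unfolding is_tableau_def by blast
  qed
  moreover have "\<exists>!c. c \<in> diagram \<alpha> \<and> (T \<circ> p) c = enat m" if "m \<in> {1..n}" for m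
  proof -
    have "\<exists>!d. d \<in> diagram \<alpha> \<and> T d = enat m"
      using assms(1) that by (simp add: tableaux_ones_def content_ones_def)
    then obtain d where d: "d \<in> diagram \<alpha>" "T d = enat m"
      and d_unique: "\<And>d'. d' \<in> diagram \<alpha> \<and> T d' = enat m \<Longrightarrow> d' = d"
      by (elim ex1E) metis
    show ?thesis
    proof (rule ex1I[of _ "inv p d"])
      show "inv p d \<in> diagram \<alpha> \<and> (T \<circ> p) (inv p d) = enat m"
        using d permutes_inverses(1)[OF assms(2), of d] mem[of "inv p d"] by simp
      fix c assume "c \<in> diagram \<alpha> \<and> (T \<circ> p) c = enat m"
      then have "p c = d"
        using d_unique[of "p c"] mem[of c] by simp
      then show "c = inv p d"
        using permutes_inverses(2)[OF assms(2), of c] by simp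
    qed
  qed
  ultimately show ?thesis
    by (simp add: tableaux_ones_def content_ones_def)
qed

text \<open>
  The convention \<open>\<infinity>\<close> outside the diagram makes the inequalities at missing
  neighbours true, and the weak inequality to the right is strict for distinct entries.
\<close>

lemma stable_iff_below_children:
  assumes "T \<in> tableaux_ones n \<alpha>" "inj_on T (diagram \<alpha>)" "c \<in> diagram \<alpha>"
  shows "stable T c \<longleftrightarrow> diagram.below_children \<alpha> T c"
proof -
  obtain i j where c: "c = (i, j)" by force
  have out: "T d = \<infinity>" if "d \<notin> diagram \<alpha>" for d
    using assms(1) that unfolding tableaux_ones_def is_tableau_def by blast
  have j: "1 \<le> j" using assms(3) c by (simp add: diagram_def)
  have fin: "T c < \<infinity>"
    using assms(1,3) by (auto simp: tableaux_ones_def is_tableau_def)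
  have right: "T c \<le> T (i, j + 1) \<longleftrightarrow> ((c, (i, j + 1)) \<in> tree_edges \<alpha> \<longrightarrow> T c < T (i, j + 1))"
  proof (cases "(i, j + 1) \<in> diagram \<alpha>")
    case True
    then have "T c \<noteq> T (i, j + 1)"
      using assms(2,3) c by (auto dest: inj_onD)
    then show ?thesis
      using True assms(3) c by (auto simp: tree_edges_def)
  next
    case False
    then show ?thesis
      using out[OF False] by (auto simp: tree_edges_def)
  qed
  have down: "T c < T (i + 1, j) \<longleftrightarrow> ((c, (i + 1, j)) \<in> tree_edges \<alpha> \<longrightarrow> T c < T (i + 1, j))"
    if "j = 1"
    using out[of "(i + 1, j)"] fin assms(3) c that by (auto simp: tree_edges_def)
  have child: "w = (i, j + 1) \<or> j = 1 \<and> w = (i + 1, j)" if "(c, w) \<in> tree_edges \<alpha>" for w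
    using that c by (auto simp: tree_edges_def)
  have "diagram.below_children \<alpha> T c \<longleftrightarrow>
      ((c, (i, j + 1)) \<in> tree_edges \<alpha> \<longrightarrow> T c < T (i, j + 1)) \<and>
      (j = 1 \<longrightarrow> (c, (i + 1, j)) \<in> tree_edges \<alpha> \<longrightarrow> T c < T (i + 1, j))"
    (is "?L \<longleftrightarrow> ?R")
  proof
    show "?L \<Longrightarrow> ?R" by (simp add: diagram.below_children_def)
    assume R: ?R
    show ?L
      unfolding diagram.below_children_def
    proof (intro allI impI)
      fix w assume "(c, w) \<in> tree_edges \<alpha>"
      with child[OF this] R show "T c < T w" by (elim disjE) simp_all
    qed
  qed
  moreover have "stable T c \<longleftrightarrow> T c \<le> T (i, j + 1) \<and> (j = 1 \<longrightarrow> T c < T (i + 1, j))"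
    using j unfolding c by auto
  ultimately show ?thesis
    using right down by blast
qed

section \<open>The steps of \<open>\<psi>\<close>\<close>

lemma bij_betw_hook_shift:
  assumes "composition n \<alpha>" "c \<in> diagram \<alpha>" "c \<notin> F" "F \<subseteq> diagram \<alpha>"
    and "tree_edges \<alpha> `` insert c F \<subseteq> F"
  shows "bij_betw (\<lambda>(P, r). circular_right_shift (hook_path c (hook_reading \<alpha> c ! (r - 1))) P)
    (diagram.increasing_labelings \<alpha> (tableaux_ones n \<alpha>) (insert c F) \<times> {1..hook_length \<alpha> c})
    (diagram.increasing_labelings \<alpha> (tableaux_ones n \<alpha>) F)"
    (is "bij_betw ?f (?A \<times> ?R) ?B")
proof -
  let ?g = "\<lambda>r. hook_path c (hook_reading \<alpha> c ! (r - 1))"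
  have g: "bij_betw ?g ?R (diagram.paths_from \<alpha> c)"
    using bij_betw_trans[OF bij_betw_hook_reading bij_betw_hook_path] assms by (simp add: comp_def)
  let ?h = "\<lambda>(P, r). P \<circ> inv (cycle_of_list (?g r)) :: tableau"
  have "bij_betw (\<lambda>(T, L). T \<circ> inv (cycle_of_list L)) (?A \<times> diagram.paths_from \<alpha> c) ?B"
    by (rule diagram.bij_betw_rotate_path)
      (use assms tableaux_ones_inj_on tableaux_ones_permute in auto)
  from bij_betw_trans[OF bij_betw_map_prod[OF bij_betw_id g] this]
  have "bij_betw ?h (?A \<times> ?R) ?B"
    by (simp add: comp_def case_prod_unfold id_def)
  moreover have "?f x = ?h x" if "x \<in> ?A \<times> ?R" for x
  proof -
    obtain P r where x: "x = (P, r)" by force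
    have "?g r \<in> diagram.paths_from \<alpha> c"
      using that x g by (auto simp: bij_betw_def)
    then show ?thesis
      using circular_right_shift_eq[of "?g r" P] diagram.distinct_path[of \<alpha> "?g r"] x
      by (simp add: diagram.paths_from_def)
  qed
  ultimately show ?thesis
    by (simp only: bij_betw_cong[of "?A \<times> ?R" ?f ?h ?B])
qed

text \<open>
  A bijection that absorbs a number \<open>J c\<close> still gives a bijection when that number comes from a
  tuple \<open>J\<close> and is then overwritten by a constant: the other coordinates are kept, and the
  lost one can be recovered from the value of \<open>f\<close>.
\<close>

lemma bij_betw_consume_coordinate:
  assumes f: "bij_betw f (A \<times> S c) A'" and c: "c \<in> D"
  shows "bij_betw (\<lambda>(P, J). (f (P, J c), J(c := d))) (A \<times> PiE D S) (A' \<times> PiE D (S(c := {d})))"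
proof -
  define g where "g = the_inv_into (A \<times> S c) f"
  have gf: "g (f x) = x" if "x \<in> A \<times> S c" for x
    using that f unfolding g_def bij_betw_def by (simp add: the_inv_into_f_f)
  have fg: "g y \<in> A \<times> S c \<and> f (g y) = y" if "y \<in> A'" for y
    using f_the_inv_into_f_bij_betw[OF f] bij_betw_the_inv_into[OF f] that
    unfolding g_def by (simp add: bij_betw_apply)
  have f_in: "f x \<in> A'" if "x \<in> A \<times> S c" for x
    using f that by (auto simp: bij_betw_def)
  have g_in: "fst (g y) \<in> A" "snd (g y) \<in> S c" and f_g: "f (fst (g y), snd (g y)) = y"
    if "y \<in> A'" for y
    using fg[OF that] by (auto simp: mem_Times_iff)
  let ?f = "\<lambda>(P, J). (f (P, J c), J(c := d))" and ?g = "\<lambda>(Q, J). (fst (g Q), J(c := snd (g Q)))"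
  have J_in: "J c \<in> S c" if "J \<in> PiE D S" for J
    using that c by blast
  have J_eq: "J c = d" if "J \<in> PiE D (S(c := {d}))" for J
    using PiE_mem[OF that c] by simp
  have upd: "J(c := e) \<in> PiE D (S(c := E))" if "J \<in> PiE D (S(c := E'))" "e \<in> E" for J e E E'
    using that c by (auto simp: PiE_iff extensional_def split: if_splits)
  show ?thesis
  proof (rule bij_betw_byWitness[where f' = ?g])
    show "\<forall>x \<in> A \<times> PiE D S. ?g (?f x) = x"
      using J_in gf by auto
    show "\<forall>y \<in> A' \<times> PiE D (S(c := {d})). ?f (?g y) = y"
      using J_eq f_g by (auto simp: fun_eq_iff)
    show "?f ` (A \<times> PiE D S) \<subseteq> A' \<times> PiE D (S(c := {d}))"
    proof clarify
      fix P J assume "P \<in> A" "J \<in> PiE D S"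
      then show "f (P, J c) \<in> A' \<and> J(c := d) \<in> PiE D (S(c := {d}))"
        using J_in[of J] f_in upd[of J "S c" d "{d}"] by simp
    qed
    show "?g ` (A' \<times> PiE D (S(c := {d}))) \<subseteq> A \<times> PiE D S"
    proof clarify
      fix Q J assume "Q \<in> A'" "J \<in> PiE D (S(c := {d}))"
      then show "fst (g Q) \<in> A \<and> J(c := snd (g Q)) \<in> PiE D S"
        using g_in[of Q] upd[of J "{d}" "snd (g Q)" "S c"] by simp
    qed
  qed
qed

definition hook_values :: "nat list \<Rightarrow> cell set \<Rightarrow> cell \<Rightarrow> nat set" where
  "hook_values \<alpha> F c = (if c \<in> F then {1..hook_length \<alpha> c} else {1})"

text \<open>
  The pairs that occur while the cells outside \<open>F\<close> have been treated and those in
  \<open>F\<close> have not: stability is guaranteed only on \<open>F\<close>, and \<open>J\<close> is 1 outside \<open>F\<close>.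
\<close>

definition psi_states :: "nat \<Rightarrow> nat list \<Rightarrow> cell set \<Rightarrow> (tableau \<times> (cell \<Rightarrow> nat)) set" where
  "psi_states n \<alpha> F =
     diagram.increasing_labelings \<alpha> (tableaux_ones n \<alpha>) F \<times> PiE (diagram \<alpha>) (hook_values \<alpha> F)"

lemma bij_betw_psi_step:
  assumes "composition n \<alpha>" "c \<in> diagram \<alpha>" "c \<notin> F" "F \<subseteq> diagram \<alpha>"
    and "tree_edges \<alpha> `` insert c F \<subseteq> F"
  shows "bij_betw (psi_step \<alpha> c) (psi_states n \<alpha> (insert c F)) (psi_states n \<alpha> F)"
proof -
  have S: "(hook_values \<alpha> (insert c F))(c := {1}) = hook_values \<alpha> F"
    "hook_values \<alpha> (insert c F) c = {1..hook_length \<alpha> c}"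
    using assms(3) by (auto simp: hook_values_def fun_eq_iff)
  have "psi_step \<alpha> c = (\<lambda>(P, J).
      ((\<lambda>(P, r). circular_right_shift (hook_path c (hook_reading \<alpha> c ! (r - 1))) P) (P, J c), J(c := 1)))"
    by auto
  then show ?thesis
    using bij_betw_consume_coordinate[where S = "hook_values \<alpha> (insert c F)" and d = 1,
        OF bij_betw_hook_shift[OF assms, folded S(2)] assms(2)]
    unfolding psi_states_def S(1) by simp
qed

definition cell_list :: "nat list \<Rightarrow> cell list" where
  "cell_list \<alpha> = linorder.sorted_list_of_set cell_le (diagram \<alpha>)"

lemma cell_list: "set (cell_list \<alpha>) = diagram \<alpha>" "distinct (cell_list \<alpha>)"
    "sorted_wrt cell_le (cell_list \<alpha>)" "length (cell_list \<alpha>) = sum_list \<alpha>"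
proof -
  interpret cell: linorder cell_le cell_less by (rule linorder_cell)
  show "set (cell_list \<alpha>) = diagram \<alpha>" "distinct (cell_list \<alpha>)"
    "sorted_wrt cell_le (cell_list \<alpha>)" "length (cell_list \<alpha>) = sum_list \<alpha>"
    unfolding cell_list_def using finite_diagram[of \<alpha>] card_diagram[of \<alpha>]
    by simp_all
qed

lemma children_earlier:
  assumes "m < sum_list \<alpha>"
  shows "tree_edges \<alpha> `` set (take (Suc m) (cell_list \<alpha>)) \<subseteq> set (take m (cell_list \<alpha>))"
proof
  fix w assume "w \<in> tree_edges \<alpha> `` set (take (Suc m) (cell_list \<alpha>))"
  then obtain k where k: "k < Suc m" "k < sum_list \<alpha>" and edge: "(cell_list \<alpha> ! k, w) \<in> tree_edges \<alpha>"
    by (auto simp: in_set_conv_nth cell_list)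
  have "w \<in> diagram \<alpha>"
    using edge by (auto simp: tree_edges_def)
  then obtain l where l: "l < sum_list \<alpha>" "w = cell_list \<alpha> ! l"
    by (metis cell_list(1,4) in_set_conv_nth)
  have "\<not> cell_le (cell_list \<alpha> ! k) w"
    using edge by (cases "cell_list \<alpha> ! k"; cases w) (auto simp: tree_edges_def)
  moreover have "cell_le w w" by (cases w) simp
  ultimately have "l < k"
    using sorted_wrt_nth_less[OF cell_list(3), of k l \<alpha>] l by (metis cell_list(4) nat_neq_iff)
  then show "w \<in> set (take m (cell_list \<alpha>))"
    using k l by (auto simp: in_set_conv_nth cell_list intro!: exI[of _ l])
qed

lemma bij_betw_psi_iter:
  assumes "composition n \<alpha>" "m \<le> n"
  shows "bij_betw (\<lambda>PJ. psi_iter \<alpha> PJ m)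
    (psi_states n \<alpha> (diagram \<alpha>)) (psi_states n \<alpha> (set (take (n - m) (cell_list \<alpha>))))"
  using assms(2)
proof (induction m)
  case 0
  have "take n (cell_list \<alpha>) = cell_list \<alpha>"
    using assms(1) cell_list(4)[of \<alpha>] by (simp add: composition_def)
  then show ?case by (simp add: cell_list bij_betw_def)
next
  case (Suc m)
  define k where "k = n - Suc m"
  have sum: "sum_list \<alpha> = n" and k: "k < n" "n - m = Suc k"
    using assms(1) Suc.prems by (auto simp: composition_def k_def)
  let ?F = "set (take k (cell_list \<alpha>))" and ?c = "cell_list \<alpha> ! k"
  have insert: "set (take (Suc k) (cell_list \<alpha>)) = insert ?c ?F"
    using k sum by (simp add: take_Suc_conv_app_nth cell_list)
  have "bij_betw (psi_step \<alpha> ?c) (psi_states n \<alpha> (insert ?c ?F)) (psi_states n \<alpha> ?F)"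
  proof (rule bij_betw_psi_step[OF assms(1)])
    show "?c \<in> diagram \<alpha>"
      using k sum by (metis cell_list(1,4) nth_mem)
    show "?c \<notin> ?F"
      using k sum cell_list[of \<alpha>] by (auto simp: in_set_conv_nth nth_eq_iff_index_eq)
    show "?F \<subseteq> diagram \<alpha>"
      using cell_list(1) set_take_subset by metis
    show "tree_edges \<alpha> `` insert ?c ?F \<subseteq> ?F"
      using children_earlier[of k \<alpha>] k sum insert by simp
  qed
  from bij_betw_trans[OF Suc.IH this[folded insert, folded k(2)]] Suc.prems
  show ?case
    using k sum by (simp add: comp_def ordered_cell_def cell_list_def[symmetric] k_def[symmetric])
qed

theorem theorem2p1:
  fixes n :: nat and \<alpha> :: "nat list"
  assumes "n \<ge> 1" and "composition n \<alpha>"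
  shows "bij_betw (psi \<alpha>) (standard_immaculate n \<alpha> \<times> hook_tableaux \<alpha>) (tableaux_ones n \<alpha>)"
proof -
  have sum: "sum_list \<alpha> = n"
    using assms(2) by (simp add: composition_def)
  obtain c where c: "take 1 (cell_list \<alpha>) = [c]"
    using assms(1) cell_list(4)[of \<alpha>] sum by (cases "cell_list \<alpha>") auto
  then have c_in: "c \<in> diagram \<alpha>"
    using cell_list(1)[of \<alpha>] by (metis in_set_takeD list.set_intros(1))
  have leaf: "tree_edges \<alpha> `` {c} = {}"
    using children_earlier[of 0 \<alpha>] assms(1) sum c by simp
  \<comment> \<open>The smallest cell is never treated. It is a leaf, so its hook is trivial: its value of \<open>J\<close> is 1
    from the start, and stability at it imposes nothing.\<close>
  have "diagram.paths_from \<alpha> c = {[c]}"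
  proof
    show "diagram.paths_from \<alpha> c \<subseteq> {[c]}"
    proof
      fix L assume "L \<in> diagram.paths_from \<alpha> c"
      then show "L \<in> {[c]}"
        using leaf by (cases L) (auto simp: diagram.paths_from_def successively_Cons)
    qed
  qed (simp add: diagram.paths_from_def)
  then have "hook_length \<alpha> c = 1"
    using bij_betw_same_card[OF bij_betw_hook_path[OF assms(2) c_in]]
    by (simp add: hook_length_def)
  then have "hook_values \<alpha> {c} = (\<lambda>d. {1})"
    by (auto simp: hook_values_def fun_eq_iff)
  then have "PiE (diagram \<alpha>) (hook_values \<alpha> {c}) = {\<lambda>d \<in> diagram \<alpha>. 1}"
    by (simp add: PiE_singleton restrict_def)
  moreover have "diagram.increasing_labelings \<alpha> (tableaux_ones n \<alpha>) {c} = tableaux_ones n \<alpha>"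
    using leaf by (auto simp: diagram.increasing_labelings_def diagram.below_children_def)
  ultimately have final: "psi_states n \<alpha> {c} = tableaux_ones n \<alpha> \<times> {\<lambda>d \<in> diagram \<alpha>. 1}"
    by (simp add: psi_states_def)
  have start: "psi_states n \<alpha> (diagram \<alpha>) = standard_immaculate n \<alpha> \<times> hook_tableaux \<alpha>"
  proof -
    have "diagram.increasing_labelings \<alpha> (tableaux_ones n \<alpha>) (diagram \<alpha>) = standard_immaculate n \<alpha>"
      using stable_iff_below_children tableaux_ones_inj_on[OF assms(2)]
      by (auto simp: diagram.increasing_labelings_def standard_immaculate_def)
    moreover have "PiE (diagram \<alpha>) (hook_values \<alpha> (diagram \<alpha>)) = hook_tableaux \<alpha>"
      unfolding hook_tableaux_def by (rule PiE_cong) (simp add: hook_values_def)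
    ultimately show ?thesis by (simp add: psi_states_def)
  qed
  have "bij_betw (\<lambda>PJ. psi_iter \<alpha> PJ (n - 1))
      (standard_immaculate n \<alpha> \<times> hook_tableaux \<alpha>) (tableaux_ones n \<alpha> \<times> {\<lambda>d \<in> diagram \<alpha>. 1})"
    using bij_betw_psi_iter[OF assms(2), of "n - 1"] assms(1) c
    by (simp add: start final)
  moreover have "bij_betw fst (tableaux_ones n \<alpha> \<times> {\<lambda>d \<in> diagram \<alpha>. 1::nat}) (tableaux_ones n \<alpha>)"
    by (auto simp: bij_betw_def inj_on_def)
  ultimately show ?thesis
    using bij_betw_trans by (fastforce simp: comp_def psi_def[abs_def] sum)
qed

end
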